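(* Let $p \neq 3$ be a prime. Then $p$ can be represented as $p = a^2+ab+b^2$ with integers $a \ge b \ge 0$ if and only if $p$ is of the form $6k+1$ for some integer $k$; moreover, when such a representation exists, it is unique, i.e. there is exactly one pair $(a,b)$ of integers with $a \ge b \ge 0$ and $p = a^2+ab+b^2$.
   Context: Two representations $a^2+ab+b^2$ and $c^2+cd+d^2$ (with $a\ge b\ge 0$ and $c\ge d\ge 0$ integers) are regarded as distinct if $a \ne c$ or $b \ne d$. *)

theory Defs
  imports "HOL-Number_Theory.Number_Theory"
begin

end

theory Submission
  imports Defs "HOL-Library.Discrete_Functions"
begin

text \<open>
  Write \<open>N(a, b) = a\<^sup>2 + ab + b\<^sup>2\<close>. If \<open>p \<equiv> 1\<close> modulo 3, then \<open>x\<^sup>2 + x + 1\<close> has a root \<open>x\<close>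
  modulo \<open>p\<close>, and Thue's lemma gives a small nonzero vector with \<open>u \<equiv> xv\<close>. Then
  \<open>N(u, v)\<close> is a multiple of \<open>p\<close> strictly between \<open>0\<close> and \<open>3p\<close>, and it is not \<open>2p\<close> because an even
  value of \<open>N\<close> is divisible by 4. The hexagonal symmetry of \<open>N\<close> moves \<open>(u, v)\<close> into the sector
  \<open>a \<ge> b \<ge> 0\<close>. Uniqueness follows from the factorisation
  \<open>d\<^sup>2 N(a, b) - b\<^sup>2 N(c, d) = (ad - bc)(ad + bc + bd)\<close>.
\<close>

section \<open>Existence of a representation\<close>

text \<open>A primitive root \<open>g\<close> has order \<open>p - 1 = 3 * m\<close>, so
  \<open>g ^ m\<close> is a cube root of unity other than 1 modulo \<open>p\<close>; it is therefore
  a root of the cofactor of \<open>x - 1\<close> in \<open>x ^ 3 - 1\<close>.\<close>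

lemma root_of_unity_polynomial_mod_prime:
  fixes p :: nat
  assumes "prime p" and "p mod 3 = 1"
  shows "\<exists>x::int. int p dvd x^2 + x + 1"
proof -
  obtain g where g: "residue_primroot p g"
    using prime_primitive_root_exists[of p] assms prime_gt_1_nat by blast
  have ord: "ord p g = p - 1"
    using g assms by (simp add: residue_primroot_def totient_prime)
  define m where "m = (p - 1) div 3"
  have m: "p - 1 = 3 * m"
    unfolding m_def using assms(2) by presburger
  have m0: "m > 0"
    using m prime_gt_1_nat[OF assms(1)] by (cases m) auto
  define x where "x = int (g ^ m)"
  have "[g ^ (3 * m) = 1] (mod p)"
    using ord m by (metis ord_divides dvd_refl)
  then have "[x ^ 3 = 1] (mod int p)"
    unfolding x_def by (metis cong_int_iff of_nat_1 of_nat_power power_mult mult.commute)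
  then have "int p dvd x ^ 3 - 1"
    by (simp add: cong_iff_dvd_diff)
  moreover have "x ^ 3 - 1 = (x - 1) * (x^2 + x + 1)"
    by (simp add: power2_eq_square power3_eq_cube algebra_simps)
  ultimately have "int p dvd x - 1 \<or> int p dvd x^2 + x + 1"
    using assms(1) by (simp add: prime_dvd_mult_iff)
  moreover have "\<not> int p dvd x - 1"
  proof
    assume "int p dvd x - 1"
    then have "[x = 1] (mod int p)"
      by (simp add: cong_iff_dvd_diff)
    then have "[g ^ m = 1] (mod p)"
      unfolding x_def by (metis cong_int_iff of_nat_1)
    then have "p - 1 dvd m"
      using ord by (metis ord_divides)
    then show False
      using m m0 by (auto dest: dvd_imp_le)
  qed
  ultimately show ?thesis
    by blast
qed

text \<open>Pigeonhole: with \<open>s\<close> the integer square root of \<open>n\<close>, there are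
  \<open>(s + 1)^2 > n\<close> pairs in \<open>{0..s} \<times> {0..s}\<close> but only
  \<open>n\<close> residues of \<open>i - x * j\<close>. Two distinct pairs collide, and their
  difference is the required vector.\<close>

lemma thue:
  fixes n :: nat and x :: int
  assumes "n > 0"
  shows "\<exists>u v :: int. (u, v) \<noteq> (0, 0) \<and> u^2 \<le> int n \<and> v^2 \<le> int n \<and> int n dvd u - x * v"
proof -
  define s where "s = int (floor_sqrt n)"
  have s0: "s \<ge> 0"
    by (simp add: s_def)
  have s: "s^2 \<le> int n"
    unfolding s_def by (metis floor_sqrt_power2_le of_nat_le_iff of_nat_power)
  define A where "A = {0..s} \<times> {0..s}"
  define f where "f = (\<lambda>(i, j). (i - x * j) mod int n)"
  have "card A = (Suc (floor_sqrt n))^2"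
    by (simp add: A_def card_cartesian_product s_def power2_eq_square nat_add_distrib)
  moreover have "f ` A \<subseteq> {0..<int n}"
    using assms by (auto simp: f_def)
  then have "card (f ` A) \<le> n"
    using card_mono[of "{0..<int n}" "f ` A"] by simp
  ultimately have "card (f ` A) < card A"
    using Suc_floor_sqrt_power2_gt[of n] by linarith
  then have "\<not> inj_on f A"
    by (rule pigeonhole)
  then obtain i j k l where A: "(i, j) \<in> A" "(k, l) \<in> A" and ne: "(i, j) \<noteq> (k, l)"
    and eq: "f (i, j) = f (k, l)"
    by (auto simp: inj_on_def)
  have "int n dvd (i - x * j) - (k - x * l)"
    using eq by (simp add: f_def mod_eq_dvd_iff)
  then have "int n dvd (i - k) - x * (j - l)"
    by (simp add: algebra_simps)
  moreover have "\<bar>i - k\<bar> \<le> \<bar>s\<bar>" "\<bar>j - l\<bar> \<le> \<bar>s\<bar>"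
    using A s0 by (auto simp: A_def)
  then have "(i - k)^2 \<le> int n" "(j - l)^2 \<le> int n"
    using s by (auto simp: abs_le_square_iff)
  ultimately show ?thesis
    using ne by (intro exI[of _ "i - k"] exI[of _ "j - l"]) auto
qed

text \<open>The lines \<open>u = 0\<close>, \<open>v = 0\<close> and \<open>u + v = 0\<close> cut
  the plane into six sectors. Each identity in \<open>rot\<close> is a symmetry of the form carrying
  one of the other five onto the quadrant \<open>u, v \<ge> 0\<close>, where a swap orders the
  coordinates.\<close>

lemma loeschian_sector:
  fixes u v :: int
  shows "\<exists>a b :: int. a \<ge> b \<and> b \<ge> 0 \<and> u^2 + u * v + v^2 = a^2 + a * b + b^2"
proof -
  have *: "\<exists>a b :: int. a \<ge> b \<and> b \<ge> 0 \<and> u^2 + u * v + v^2 = a^2 + a * b + b^2"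
    if "u \<ge> 0" "v \<ge> 0" for u v :: int
  proof (cases "u \<ge> v")
    case True
    then show ?thesis
      using that by blast
  next
    case False
    then show ?thesis
      using that by (intro exI[of _ v] exI[of _ u]) (auto simp: algebra_simps)
  qed
  have rot: "u^2 + u * v + v^2 = (u + v)^2 + (u + v) * (- v) + (- v)^2"
    "u^2 + u * v + v^2 = (u + v)^2 + (u + v) * (- u) + (- u)^2"
    "u^2 + u * v + v^2 = (- u - v)^2 + (- u - v) * v + v^2"
    "u^2 + u * v + v^2 = (- u - v)^2 + (- u - v) * u + u^2"
    "u^2 + u * v + v^2 = (- u)^2 + (- u) * (- v) + (- v)^2"
    by (simp_all add: power2_eq_square algebra_simps)
  consider "u \<ge> 0" "v \<ge> 0" | "u \<le> 0" "v \<le> 0" | "v \<le> 0" "u + v \<ge> 0" | "u \<le> 0" "u + v \<ge> 0"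
    | "v \<ge> 0" "u + v \<le> 0" | "u \<ge> 0" "u + v \<le> 0"
    by linarith
  then show ?thesis
  proof cases
    case 1
    then show ?thesis by (rule *)
  next
    case 2
    then show ?thesis unfolding rot(5) by (intro *) auto
  next
    case 3
    then show ?thesis unfolding rot(1) by (intro *) auto
  next
    case 4
    then show ?thesis unfolding rot(2) by (intro *) auto
  next
    case 5
    then show ?thesis unfolding rot(3) by (intro *) auto
  next
    case 6
    then show ?thesis unfolding rot(4) by (intro *) auto
  qed
qed

text \<open>Modulo 2 the form vanishes only at the origin.\<close>

lemma even_loeschian:
  fixes u v :: int
  assumes "even (u^2 + u * v + v^2)"
  shows "4 dvd u^2 + u * v + v^2"
proof -
  have "even u" "even v"
    using assms by auto
  then obtain a b where "u = 2 * a" "v = 2 * b"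
    by (auto elim!: evenE)
  then show ?thesis
    by (simp add: power2_eq_square)
qed

lemma prime_ne_square:
  fixes p u :: int
  assumes "prime p"
  shows "p \<noteq> u^2"
  using assms prime_power_iff[of u 2] by auto

lemma loeschian_exists:
  fixes p :: int
  assumes "prime p" and "p mod 6 = 1"
  shows "\<exists>a b :: int. a \<ge> b \<and> b \<ge> 0 \<and> p = a^2 + a * b + b^2"
proof -
  have p: "p > 1"
    using assms(1) by (rule prime_gt_1_int)
  have "p mod 3 = 1"
    using assms(2) by presburger
  then have "nat p mod 3 = 1"
    using nat_mod_distrib[of p 3] p by simp
  moreover have "prime (nat p)"
    using assms(1) prime_int_nat_transfer[of p] by blast
  ultimately obtain x :: int where x: "p dvd x^2 + x + 1"
    using root_of_unity_polynomial_mod_prime[of "nat p"] p by auto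
  obtain u v :: int where ne: "(u, v) \<noteq> (0, 0)" and u: "u^2 \<le> p" and v: "v^2 \<le> p"
    and d: "p dvd u - x * v"
    using thue[of "nat p" x] p by auto
  define N where "N = u^2 + u * v + v^2"
  \<comment> \<open>An exact version of: \<open>u\<close> is congruent to \<open>x * v\<close>,
    hence \<open>N\<close> to \<open>v^2 * (x^2 + x + 1)\<close>.\<close>
  have "N = (u - x * v) * (u + x * v + v) + v^2 * (x^2 + x + 1)"
    by (simp add: N_def power2_eq_square algebra_simps)
  then have "p dvd N"
    using d x by simp
  then obtain k where k: "N = p * k"
    by blast
  have "2 * N = (u + v)^2 + u^2 + v^2"
    by (simp add: N_def power2_eq_square algebra_simps)
  then have "2 * N > 0"
    using ne by (metis add_nonneg_pos add_pos_nonneg add.assoc sum_power2_gt_zero_iff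
        zero_le_power2 prod.inject)
  then have "k > 0"
    using k p by (simp add: zero_less_mult_iff)
  have "u^2 < p" "v^2 < p"
    using u v prime_ne_square[OF assms(1)] by (metis order_le_less)+
  \<comment> \<open>Bounds \<open>N\<close> by \<open>3/2 * (u^2 + v^2)\<close>, which is below
    \<open>3 * p\<close>.\<close>
  moreover have "2 * (u * v) \<le> u^2 + v^2"
    using zero_le_power2[of "u - v"] by (simp add: power2_diff)
  ultimately have "p * k < p * 3"
    using k N_def by linarith
  then have "k < 3"
    using p by simp
  moreover have "k \<noteq> 2"
  proof
    assume "k = 2"
    then have "4 dvd p * 2"
      using even_loeschian[of u v] k unfolding N_def by (metis dvd_triv_right)
    then show False
      using assms(2) by presburger
  qed
  ultimately have "N = p"
    using k \<open>k > 0\<close> by (cases "k = 1") auto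
  then show ?thesis
    using loeschian_sector[of u v] N_def by simp
qed

section \<open>Necessity of the congruence\<close>

text \<open>Modulo 3 the form is the square of \<open>a - b\<close>, and 2 is not a square there;
  modulo 2, an even value would be a multiple of 4.\<close>

lemma loeschian_prime_mod_6:
  fixes p a b :: int
  assumes "prime p" and "p \<noteq> 3" and N: "p = a^2 + a * b + b^2"
  shows "p mod 6 = 1"
proof -
  have no_dvd: "\<not> q dvd p" if "prime q" "q \<noteq> p" for q :: int
    using that assms(1) by (auto dest: primes_dvd_imp_eq)
  have "odd p"
  proof
    assume "even p"
    then have "4 dvd p"
      using even_loeschian N by simp
    moreover from this have "p \<noteq> 2"
      by auto
    ultimately show False
      using no_dvd[of 2] \<open>even p\<close> by simp
  qed
  moreover have "p mod 3 \<noteq> 0"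
    using no_dvd[of 3] assms(2) by (auto simp: dvd_eq_mod_eq_0)
  moreover have "p mod 3 \<noteq> 2"
  proof -
    have "p = (a - b)^2 + 3 * (a * b)"
      by (simp add: N power2_eq_square algebra_simps)
    then have "p mod 3 = (a - b)^2 mod 3"
      by simp
    also have "\<dots> = ((a - b) mod 3)^2 mod 3"
      by (simp add: power_mod)
    also have "\<dots> \<noteq> 2"
    proof -
      have "(a - b) mod 3 = 0 \<or> (a - b) mod 3 = 1 \<or> (a - b) mod 3 = 2"
        by presburger
      then show ?thesis
        by auto
    qed
    finally show ?thesis .
  qed
  ultimately show ?thesis
    by presburger
qed

section \<open>Uniqueness\<close>

lemma loeschian_prime_unique:
  fixes p a b c d :: int
  assumes "prime p" and "p \<noteq> 3"
    and ab: "a \<ge> b" "b \<ge> 0" "p = a^2 + a * b + b^2"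
    and cd: "c \<ge> d" "d \<ge> 0" "p = c^2 + c * d + d^2"
  shows "a = c \<and> b = d"
proof -
  have p: "p > 1"
    using assms(1) by (rule prime_gt_1_int)
  have pos: "a > 0" "c > 0"
    using ab cd p by (auto simp: order_less_le)
  have "d^2 * (a^2 + a * b + b^2) - b^2 * (c^2 + c * d + d^2)
      = (a * d - b * c) * (a * d + b * c + b * d)"
    by (simp add: power2_eq_square algebra_simps)
  then have "(a * d - b * c) * (a * d + b * c + b * d) = p * (d^2 - b^2)"
    unfolding ab(3)[symmetric] cd(3)[symmetric] by (simp add: algebra_simps)
  then have "p dvd (a * d - b * c) * (a * d + b * c + b * d)"
    by simp
  then have "p dvd a * d - b * c \<or> p dvd a * d + b * c + b * d"
    using assms(1) by (simp add: prime_dvd_mult_iff)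
  then have cross: "a * d = b * c"
  proof
    assume dvd: "p dvd a * d - b * c"
    \<comment> \<open>Since \<open>a^2 \<le> p\<close> and \<open>2 * d^2 \<le> p\<close>, the mean
      inequality gives \<open>2 * a * d \<le> 3/2 * p\<close>. The variables are generalized so that
      the two representations can be exchanged.\<close>
    have bound: "a * d < p" if "p = a^2 + a * b + b^2" "p = c^2 + c * d + d^2"
        "a > 0" "b \<ge> 0" "c \<ge> d" "d \<ge> 0" for a b c d :: int
    proof -
      have "d * d \<le> c * c"
        using that by (intro mult_mono) auto
      moreover have "0 \<le> c * d" "0 \<le> a * b" "0 \<le> b * b"
        using that by auto
      ultimately have "a * a \<le> p" "2 * (d * d) \<le> p"
        using that(1,2) by (simp_all add: power2_eq_square)
      moreover have "0 \<le> (a - d)^2"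
        by simp
      ultimately show ?thesis
        using p by (simp add: power2_eq_square algebra_simps)
    qed
    have "a * d < p" "c * b < p"
      using bound[of a b c d] bound[of c d a b] ab cd pos by auto
    moreover have "a * d \<ge> 0" "b * c \<ge> 0"
      using ab cd pos by auto
    ultimately have "\<bar>a * d - b * c\<bar> < p"
      by (simp add: mult.commute[of c b])
    then show ?thesis
      using dvd by (metis dvd_imp_le_int eq_iff_diff_eq_0 abs_of_pos not_less p zero_less_one less_trans)
  next
    \<comment> \<open>With \<open>w\<close> a primitive complex cube root of unity,
      \<open>a - b * w\<close> has norm \<open>a^2 + a * b + b^2\<close>, and
      \<open>(a - b * w) * (c - d * w) = W - Z * w\<close>. The identity \<open>norm\<close> below
      is multiplicativity of this norm.\<close>
    define Z W where "Z = a * d + b * c + b * d" and "W = a * c - b * d"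
    assume "p dvd a * d + b * c + b * d"
    then obtain k where k: "Z = p * k"
      unfolding Z_def by blast
    have "Z \<ge> 0"
      using ab cd pos by (simp add: Z_def)
    have "b * d \<le> b * c" "b * c \<le> a * c"
      using ab cd pos by (auto intro: mult_left_mono mult_right_mono)
    then have "W \<ge> 0"
      by (simp add: W_def)
    have "p * p = (a^2 + a * b + b^2) * (c^2 + c * d + d^2)"
      using ab cd by simp
    also have "\<dots> = W^2 + W * Z + Z^2"
      by (simp add: W_def Z_def power2_eq_square algebra_simps)
    finally have norm: "p * p = W^2 + W * Z + Z^2" .
    show ?thesis
    proof (cases "Z = 0")
      case True
      \<comment> \<open>The summands of \<open>Z\<close> are nonnegative, so \<open>a * d\<close>
        and \<open>b * c\<close> both vanish.\<close>
      then show ?thesis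
        using ab cd pos unfolding Z_def by (smt (verit) mult_nonneg_nonneg)
    next
      case False
      then have "k \<ge> 1"
        using k \<open>Z \<ge> 0\<close> p by (smt (verit) mult_nonneg_nonpos mult_eq_0_iff)
      then have "Z \<ge> p"
        using k p by simp
      \<comment> \<open>\<open>Z \<ge> p\<close> already exhausts the norm \<open>p * p\<close>,
        which forces \<open>W = 0\<close>. The chain \<open>b * d \<le> b * c \<le> a * c\<close>
        then collapses, so \<open>a = b\<close> and 3 divides \<open>p\<close>.\<close>
      then have "Z * Z \<ge> p * p" "W * Z \<ge> W * p"
        using p \<open>W \<ge> 0\<close> by (auto intro: mult_mono mult_left_mono)
      then have "W * p \<le> 0"
        using norm[unfolded power2_eq_square] zero_le_square[of W] by linarith
      then have "W = 0"
        using p \<open>W \<ge> 0\<close> by (simp add: mult_le_0_iff)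
      then have "b * c = a * c"
        using \<open>b * d \<le> b * c\<close> \<open>b * c \<le> a * c\<close> by (simp add: W_def)
      then have "b = a"
        using pos by simp
      then have "p = 3 * a^2"
        using ab(3) by (simp add: power2_eq_square)
      then have "3 dvd p"
        by simp
      then have "p = 3"
        using assms(1) primes_dvd_imp_eq[of 3 p] by simp
      then show ?thesis
        using assms(2) by simp
    qed
  qed
  \<comment> \<open>By \<open>cross\<close>, scaling \<open>(a, b)\<close> by \<open>d\<close> and
    \<open>(c, d)\<close> by \<open>b\<close> yields the same vector; comparing norms gives
    \<open>d = b\<close>.\<close>
  have "d^2 * p = (a * d)^2 + (a * d) * (b * d) + (b * d)^2"
    by (simp add: ab(3) power2_eq_square algebra_simps)
  also have "\<dots> = b^2 * p"
    unfolding cross by (simp add: cd(3) power2_eq_square algebra_simps)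
  finally have "d = b"
    using p ab cd by simp
  moreover have "a = c"
  proof -
    have "(a - c) * (a + c + b) = 0"
      using ab(3) cd(3) \<open>d = b\<close> by (simp add: power2_eq_square algebra_simps)
    then show ?thesis
      using pos ab by simp
  qed
  ultimately show ?thesis
    by simp
qed

theorem theorem8:
  fixes p :: int
  assumes "prime p" and "p \<noteq> 3"
  shows "((\<exists>a b :: int. a \<ge> b \<and> b \<ge> 0 \<and> p = a^2 + a * b + b^2) \<longleftrightarrow> (\<exists>k :: int. p = 6 * k + 1))
    \<and> ((\<exists>a b :: int. a \<ge> b \<and> b \<ge> 0 \<and> p = a^2 + a * b + b^2) \<longrightarrow>
        (\<exists>!(a :: int, b :: int). a \<ge> b \<and> b \<ge> 0 \<and> p = a^2 + a * b + b^2))"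
proof (intro conjI impI)
  have "(\<exists>k :: int. p = 6 * k + 1) \<longleftrightarrow> p mod 6 = 1"
    by presburger
  then show "(\<exists>a b :: int. a \<ge> b \<and> b \<ge> 0 \<and> p = a^2 + a * b + b^2) \<longleftrightarrow> (\<exists>k :: int. p = 6 * k + 1)"
    using loeschian_exists loeschian_prime_mod_6 assms by metis
next
  assume "\<exists>a b :: int. a \<ge> b \<and> b \<ge> 0 \<and> p = a^2 + a * b + b^2"
  then obtain a b :: int where "a \<ge> b" "b \<ge> 0" "p = a^2 + a * b + b^2"
    by blast
  then show "\<exists>!(a :: int, b :: int). a \<ge> b \<and> b \<ge> 0 \<and> p = a^2 + a * b + b^2"
    using loeschian_prime_unique[OF assms] by (intro ex1I[of _ "(a, b)"]) auto
qed

end
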